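(* Let $q$ be a prime power, let $F$ be a field containing $\mathbb{F}_q$, let $d\ge 1$ and $1\le s\le q$ be integers, let $b_1,\dots,b_d\in F$ be linearly independent over $\mathbb{F}_q$, and let $B_{ij}\in F$ for $1\le i\le d$, $1\le j\le s$. Then $$\prod_{j=1}^s\ \sum_{\theta\in \mathbb{F}_q^d\setminus\{0\}}\frac{\sum_{i=1}^d\theta_iB_{ij}}{\sum_{i=1}^d \theta_ib_i} =(-1)^{s-1} \sum_{\theta\in \mathbb{F}_q^d\setminus\{0\}} \frac{\prod_{j=1}^s \big(\sum_{i=1}^d \theta_iB_{ij}\big)}{\big(\sum_{i=1}^d \theta_ib_i\big)^s},$$ where $\theta=(\theta_1,\dots,\theta_d)$. *)

theory Defs
  imports "HOL-Number_Theory.Prime_Powers" "HOL-Library.FuncSet"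
    "HOL-Algebra.Embedded_Algebras" "HOL-Algebra.Algebraic_Closure_Type"
begin

definition is_subfield :: "'a::field set \<Rightarrow> bool" where
  "is_subfield K \<longleftrightarrow>
     0 \<in> K \<and> 1 \<in> K \<and>
     (\<forall>x\<in>K. \<forall>y\<in>K. x + y \<in> K \<and> x * y \<in> K) \<and>
     (\<forall>x\<in>K. - x \<in> K \<and> inverse x \<in> K)"

definition lin_indep_family :: "'a::field set \<Rightarrow> 'i set \<Rightarrow> ('i \<Rightarrow> 'a) \<Rightarrow> bool" where
  "lin_indep_family K I b \<longleftrightarrow>
     (\<forall>c. (\<forall>i\<in>I. c i \<in> K) \<longrightarrow> (\<Sum>i\<in>I. c i * b i) = 0 \<longrightarrow> (\<forall>i\<in>I. c i = 0))"

text \<open>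
  Both notions agree with those of HOL-Algebra when the ambient field type is viewed as a
  record structure; see \<open>is_subfield_iff_subfield\<close> and \<open>lin_indep_family_iff_independent\<close>.
\<close>

lemma inv_ring_of_type:
  fixes x :: "'a::field"
  assumes "x \<noteq> 0"
  shows "m_inv (ring_of_type_algebra :: 'a ring) x = inverse x"
proof -
  interpret R: field "ring_of_type_algebra :: 'a ring" by (rule field_from_type_algebra)
  show ?thesis
    by (rule R.comm_inv_char) (use assms in \<open>auto simp: ring_of_type_algebra_def\<close>)
qed

lemma minus_ring_of_type:
  fixes x :: "'a::field"
  shows "a_inv (ring_of_type_algebra :: 'a ring) x = - x"
proof -
  interpret R: field "ring_of_type_algebra :: 'a ring" by (rule field_from_type_algebra)
  show ?thesis
    by (rule R.minus_equality) (auto simp: ring_of_type_algebra_def)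
qed

lemma is_subfield_iff_subfield:
  fixes K :: "'a::field set"
  shows "is_subfield K \<longleftrightarrow> subfield K (ring_of_type_algebra :: 'a ring)"
proof -
  let ?R = "ring_of_type_algebra :: 'a ring"
  interpret R: field ?R by (rule field_from_type_algebra)
  have [simp]: "carrier ?R = UNIV" "ring.zero ?R = 0" "monoid.one ?R = 1" "add ?R x y = x + y"
    "monoid.mult ?R x y = x * y" for x y
    by (simp_all add: ring_of_type_algebra_def)
  show ?thesis
  proof
    assume K: "is_subfield K"
    have "subring K ?R"
    proof (rule R.subringI)
      fix h assume "h \<in> K"
      then show "a_inv ?R h \<in> K"
        using K by (simp add: is_subfield_def minus_ring_of_type)
    qed (use K in \<open>simp_all add: is_subfield_def\<close>)
    then show "subfield K ?R"
    proof (rule R.subfieldI')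
      fix k assume "k \<in> K - {ring.zero ?R}"
      then have "k \<in> K" "k \<noteq> 0" by simp_all
      then show "m_inv ?R k \<in> K"
        using K by (simp add: is_subfield_def inv_ring_of_type)
    qed
  next
    assume K: "subfield K ?R"
    note S = subringE[OF subfieldE(1)[OF K]]
    have z: "0 \<in> K" using S(2) by simp
    have inv: "inverse x \<in> K" if "x \<in> K" for x
    proof (cases "x = 0")
      case False
      then show ?thesis
        using R.subfield_m_inv(1)[OF K, of x] that by (simp add: inv_ring_of_type)
    qed (use z in simp)
    have um: "- x \<in> K" if "x \<in> K" for x
      using S(5)[OF that] by (simp add: minus_ring_of_type)
    have "1 \<in> K" using S(3) by simp
    moreover have "x * y \<in> K" if "x \<in> K" "y \<in> K" for x y
      using S(6)[OF that] by simp
    moreover have "x + y \<in> K" if "x \<in> K" "y \<in> K" for x y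
      using S(7)[OF that] by simp
    ultimately show "is_subfield K"
      using z inv um by (simp add: is_subfield_def)
  qed
qed

lemma combine_ring_of_type:
  fixes Ks Us :: "'a::field list"
  shows "ring.combine (ring_of_type_algebra :: 'a ring) Ks Us
           = (\<Sum>i<min (length Ks) (length Us). Ks ! i * Us ! i)"
proof -
  interpret R: field "ring_of_type_algebra :: 'a ring" by (rule field_from_type_algebra)
  have [simp]: "ring.zero (ring_of_type_algebra :: 'a ring) = 0"
    "add (ring_of_type_algebra :: 'a ring) x y = x + y"
    "monoid.mult (ring_of_type_algebra :: 'a ring) x y = x * y" for x y
    by (simp_all add: ring_of_type_algebra_def)
  show ?thesis
    by (induction Ks Us rule: R.combine.induct) (simp_all add: sum.lessThan_Suc_shift del: sum.lessThan_Suc)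
qed

lemma lin_indep_family_iff_independent:
  fixes K :: "'a::field set"
  assumes "is_subfield K"
  shows "lin_indep_family K {1..d} b \<longleftrightarrow>
           ring.independent (ring_of_type_algebra :: 'a ring) K (map b [1..<Suc d])"
proof -
  let ?R = "ring_of_type_algebra :: 'a ring"
  let ?U = "map b [1..<Suc d]"
  interpret R: field ?R by (rule field_from_type_algebra)
  have z: "ring.zero ?R = 0" and car: "carrier ?R = UNIV"
    by (simp_all add: ring_of_type_algebra_def)
  have K: "subfield K ?R" and K0: "0 \<in> K"
    using assms is_subfield_iff_subfield[of K] by (blast, simp add: is_subfield_def)
  have nth: "?U ! i = b (Suc i)" if "i < d" for i
    using that by (simp add: nth_append del: upt_Suc)
  have shift: "(\<Sum>i=1..d. f i) = (\<Sum>i<d. f (Suc i))" for f :: "nat \<Rightarrow> 'a"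
    by (simp add: sum.atLeast1_atMost_eq)
  show ?thesis
  proof
    assume L: "lin_indep_family K {1..d} b"
    show "R.independent K ?U"
    proof (rule R.trivial_combine_imp_independent[OF K])
      show "set ?U \<subseteq> carrier ?R" by (simp add: car)
      fix Ks assume Ks: "set Ks \<subseteq> K" "R.combine Ks ?U = ring.zero ?R"
      define c where "c i = (if i - 1 < length Ks then Ks ! (i - 1) else 0)" for i
      have cK: "\<forall>i\<in>{1..d}. c i \<in> K"
        using Ks(1) K0 by (auto simp: c_def)
      have "(\<Sum>i=1..d. c i * b i) = (\<Sum>i<d. c (Suc i) * b (Suc i))"
        by (rule shift)
      also have "\<dots> = (\<Sum>i<min (length Ks) d. c (Suc i) * b (Suc i))"
        by (rule sum.mono_neutral_right) (auto simp: c_def)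
      also have "\<dots> = (\<Sum>i<min (length Ks) d. Ks ! i * ?U ! i)"
        by (rule sum.cong) (auto simp: c_def nth simp del: upt_Suc)
      also have "\<dots> = R.combine Ks ?U"
        by (simp add: combine_ring_of_type del: upt_Suc)
      finally have "(\<Sum>i=1..d. c i * b i) = 0" using Ks(2) z by simp
      then have c0: "\<forall>i\<in>{1..d}. c i = 0"
        using L cK unfolding lin_indep_family_def by blast
      have "Ks ! i = 0" if "i < d" "i < length Ks" for i
        using c0[rule_format, of "Suc i"] that by (simp add: c_def)
      then show "set (take (length ?U) Ks) \<subseteq> {ring.zero ?R}"
        by (auto simp: z in_set_conv_nth simp del: upt_Suc)
    qed
  next
    assume I: "R.independent K ?U"
    show "lin_indep_family K {1..d} b"
      unfolding lin_indep_family_def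
    proof (intro allI impI)
      fix c assume c: "\<forall>i\<in>{1..d}. c i \<in> K" "(\<Sum>i=1..d. c i * b i) = 0"
      let ?Ks = "map c [1..<Suc d]"
      have nthc: "?Ks ! i = c (Suc i)" if "i < d" for i
        using that by (simp add: nth_append del: upt_Suc)
      have sub: "set ?Ks \<subseteq> K" using c(1) by auto
      have "R.combine ?Ks ?U = (\<Sum>i<d. ?Ks ! i * ?U ! i)"
        by (simp add: combine_ring_of_type del: upt_Suc)
      also have "\<dots> = (\<Sum>i<d. c (Suc i) * b (Suc i))"
        by (rule sum.cong) (simp_all add: nth nthc del: upt_Suc)
      also have "\<dots> = (\<Sum>i=1..d. c i * b i)"
        by (rule shift[symmetric])
      also have "\<dots> = ring.zero ?R" using c(2) by (simp only: z)
      finally have "set (take (length ?U) ?Ks) \<subseteq> {ring.zero ?R}"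
        by (rule R.independent_imp_trivial_combine[OF K I sub])
      then show "\<forall>i\<in>{1..d}. c i = 0"
        by (fastforce simp: z image_subset_iff simp del: upt_Suc)
    qed
  qed
qed

end

theory Submission
  imports Defs
begin

text \<open>
  Let \<open>W\<close> be the \<open>K\<close>-span of the \<open>b\<^sub>i\<close>, so that \<open>w = \<Sum>\<^sub>i \<theta>\<^sub>i b\<^sub>i\<close> is a bijective parametrization of
  \<open>W\<close> by \<open>\<theta>\<close>. Each linear form \<open>\<Sum>\<^sub>i \<theta>\<^sub>i B\<^sub>i\<^sub>j\<close> equals \<open>f\<^sub>j(w)\<close> for some polynomial \<open>f\<^sub>j = X g\<^sub>j\<close>, which
  acts \<open>K\<close>-linearly and has degree at most \<open>q\<^sup>d\<^sup>-\<^sup>1\<close>. Hence the left-hand side is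
  \<open>\<Prod>\<^sub>j \<Sum>\<^sub>w g\<^sub>j(w)\<close> and the sum on the right is \<open>\<Sum>\<^sub>w \<Prod>\<^sub>j g\<^sub>j(w)\<close>, with \<open>w\<close> ranging over \<open>W - {0}\<close>.
  A polynomial \<open>g\<close> of degree less than \<open>card W - 1\<close> sums to \<open>0\<close> over \<open>W\<close>, that is, to \<open>- g(0)\<close> over
  \<open>W - {0}\<close>. As \<open>s \<le> q\<close>, the product of the \<open>g\<^sub>j\<close> has degree at most \<open>q\<^sup>d - q\<close>, so both sides equal
  \<open>(-1)\<^sup>s \<Prod>\<^sub>j g\<^sub>j(0)\<close>.
\<close>

subsection \<open>Power sums over finite additive subgroups\<close>

lemma degree_prod_linear:
  fixes f :: "'b \<Rightarrow> 'a::field"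
  shows "Polynomial.degree (\<Prod>w\<in>W. [:f w, 1:]) = card W"
  by (subst degree_prod_eq_sum_degree) auto

lemma coeff_prod_linear:
  fixes f :: "'b \<Rightarrow> 'a::field"
  shows "Polynomial.coeff (\<Prod>w\<in>W. [:f w, 1:]) (card W) = 1"
  using lead_coeff_prod[of "\<lambda>w. [:f w, 1:]" W] by (simp add: degree_prod_linear)

text \<open>Interpolating \<open>g\<close> at the points of \<open>W\<close> writes
  \<open>c * g\<close> as a combination of monic products of degree \<open>card W - 1\<close>. Their
  weights \<open>g(w)\<close> add up to the coefficient of X^(card W - 1), which vanishes by the
  degree bound.\<close>

lemma sum_poly_additive_subgroup:
  fixes W :: "'a::field set"
  assumes fin: "finite W" and diff: "\<And>x y. x \<in> W \<Longrightarrow> y \<in> W \<Longrightarrow> x - y \<in> W"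
    and deg: "Polynomial.degree g + 1 < card W"
  shows "(\<Sum>w\<in>W. poly g w) = 0"
proof -
  define L where "L = (\<Sum>w\<in>W. Polynomial.smult (poly g w) (\<Prod>u\<in>W-{w}. [:-u, 1:]))"
  define c where "c = (\<Prod>v\<in>W-{0}. v)"
  have cardW: "card (W - {w}) = card W - 1" if "w \<in> W" for w
    using that fin by simp
  \<comment> \<open>The reflection \<open>u \<mapsto> x - u\<close> carries \<open>W - {x}\<close>
    onto \<open>W - {0}\<close>.\<close>
  have c: "(\<Prod>u\<in>W-{x}. x - u) = c" if "x \<in> W" for x
    unfolding c_def
    by (rule prod.reindex_bij_witness[where i="\<lambda>v. x - v" and j="\<lambda>u. x - u"])
       (use that diff in auto)
  \<comment> \<open>Lagrange interpolation: by translation invariance all denominators are the same \<open>c\<close>.\<close>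
  have "L = Polynomial.smult c g"
  proof (rule poly_eqI_degree)
    fix x assume x: "x \<in> W"
    have "poly L x = (\<Sum>w\<in>W. poly g w * (\<Prod>u\<in>W-{w}. x - u))"
      by (simp add: L_def poly_sum poly_prod)
    also have "\<dots> = (\<Sum>w\<in>W. if w = x then poly g x * c else 0)"
    proof (rule sum.cong)
      fix w assume "w \<in> W"
      show "poly g w * (\<Prod>u\<in>W-{w}. x - u) = (if w = x then poly g x * c else 0)"
        using c[OF x] x fin by auto
    qed simp
    also have "\<dots> = poly (Polynomial.smult c g) x"
      using x fin by simp
    finally show "poly L x = poly (Polynomial.smult c g) x" .
  next
    have "Polynomial.degree L \<le> card W - 1"
      unfolding L_def
    proof (rule degree_sum_le[OF fin])
      fix w assume w: "w \<in> W"
      show "Polynomial.degree (Polynomial.smult (poly g w) (\<Prod>u\<in>W-{w}. [:-u, 1:])) \<le> card W - 1"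
        using degree_smult_le[of "poly g w" "\<Prod>u\<in>W-{w}. [:-u, 1:]"]
        by (simp only: degree_prod_linear cardW[OF w])
    qed
    then show "Polynomial.degree L < card W" using deg by linarith
    show "Polynomial.degree (Polynomial.smult c g) < card W"
      using degree_smult_le[of c g] deg by linarith
  qed
  then have "Polynomial.coeff L (card W - 1) = c * Polynomial.coeff g (card W - 1)"
    by simp
  also have "\<dots> = 0"
    using deg by (simp add: coeff_eq_0)
  also have "Polynomial.coeff L (card W - 1) = (\<Sum>w\<in>W. poly g w)"
    unfolding L_def coeff_sum
  proof (rule sum.cong)
    fix w assume w: "w \<in> W"
    show "Polynomial.coeff (Polynomial.smult (poly g w) (\<Prod>u\<in>W-{w}. [:-u, 1:])) (card W - 1) = poly g w"
      using coeff_prod_linear[of uminus "W - {w}"] by (simp add: cardW[OF w])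
  qed simp
  finally show ?thesis by simp
qed

corollary sum_poly_additive_subgroup_nonzero:
  fixes W :: "'a::field set"
  assumes "finite W" and "\<And>x y. x \<in> W \<Longrightarrow> y \<in> W \<Longrightarrow> x - y \<in> W" and "0 \<in> W"
    and "Polynomial.degree g + 1 < card W"
  shows "(\<Sum>w\<in>W-{0}. poly g w) = - poly g 0"
  using sum_poly_additive_subgroup[OF assms(1,2,4)] sum.remove[OF assms(1,3), of "poly g"]
  by (simp add: eq_neg_iff_add_eq_0 add.commute)

subsection \<open>Linear polynomials over a finite subfield\<close>

definition vanishing_poly :: "'a::field set \<Rightarrow> 'a poly" where
  "vanishing_poly W = (\<Prod>w\<in>W. [:-w, 1:])"

lemma poly_vanishing_poly: "poly (vanishing_poly W) x = (\<Prod>w\<in>W. x - w)"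
  by (simp add: vanishing_poly_def poly_prod)

lemma degree_vanishing_poly: "Polynomial.degree (vanishing_poly W) = card W"
  unfolding vanishing_poly_def by (rule degree_prod_linear)

text \<open>A condition on the polynomial function, not on the shape of \<open>f\<close> as a sum of
  terms a X^(q^i): only values of \<open>f\<close> at points are ever compared.\<close>

definition linear_poly_on :: "'a::field set \<Rightarrow> 'a poly \<Rightarrow> bool" where
  "linear_poly_on K f \<longleftrightarrow> (\<forall>x y. poly f (x + y) = poly f x + poly f y) \<and>
     (\<forall>c\<in>K. \<forall>x. poly f (c * x) = c * poly f x)"

lemma linear_poly_on_0 [simp]: "linear_poly_on K 0"
  by (simp add: linear_poly_on_def)

lemma linear_poly_on_add:
  "linear_poly_on K f \<Longrightarrow> linear_poly_on K g \<Longrightarrow> linear_poly_on K (f + g)"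
  by (simp add: linear_poly_on_def algebra_simps)

lemma linear_poly_on_smult: "linear_poly_on K f \<Longrightarrow> linear_poly_on K (Polynomial.smult a f)"
  by (simp add: linear_poly_on_def algebra_simps)

lemma linear_poly_on_poly_0:
  assumes "linear_poly_on K f"
  shows "poly f 0 = 0"
  using assms unfolding linear_poly_on_def by (metis add.right_neutral add_left_cancel)

lemma linear_poly_on_sum:
  assumes "linear_poly_on K f" and "\<And>i. i \<in> I \<Longrightarrow> c i \<in> K"
  shows "poly f (\<Sum>i\<in>I. c i * b i) = (\<Sum>i\<in>I. c i * poly f (b i))"
  using assms(2)
proof (induction I rule: infinite_finite_induct)
  case (insert i I)
  then show ?case
    using assms(1) by (simp add: linear_poly_on_def)
qed (use linear_poly_on_poly_0[OF assms(1)] in auto)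

text \<open>For nonzero \<open>c\<close>, multiplication by \<open>c\<close> permutes
  \<open>K - {0}\<close>, so the product of the nonzero elements absorbs the factor c^(card K -
  1).\<close>

lemma is_subfield_power_card:
  assumes K: "is_subfield K" and fin: "finite K" and c: "c \<in> K"
  shows "c ^ card K = c"
proof (cases "c = 0")
  case True
  then show ?thesis using fin c by (auto simp: card_gt_0_iff)
next
  case False
  have "(\<Prod>k\<in>K-{0}. c * k) = (\<Prod>k\<in>K-{0}. k)"
  proof (rule prod.reindex_bij_witness[where i="\<lambda>k. inverse c * k" and j="\<lambda>k. c * k"])
  qed (use K c False in \<open>auto simp: is_subfield_def\<close>)
  then have "c ^ card (K - {0}) = 1"
    using fin by (simp add: prod.distrib)
  moreover have "card K = Suc (card (K - {0}))"
    using K fin card.remove[of K 0] by (simp add: is_subfield_def)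
  ultimately show ?thesis by simp
qed

lemma is_subfield_power_card_power:
  assumes "is_subfield K" and "finite K" and "c \<in> K"
  shows "c ^ (card K ^ n) = c"
  by (induction n) (simp_all add: power_mult is_subfield_power_card[OF assms])

text \<open>Additivity comes from the invariance of \<open>W\<close> under translation by its own
  elements. Homogeneity comes from scaling \<open>W\<close> by \<open>c\<close>, which pulls out
  \<open>c ^ card W\<close>; this equals \<open>c\<close> because \<open>card W\<close> is a power
  of \<open>card K\<close>.\<close>

lemma linear_vanishing_poly:
  fixes W :: "'a::field set"
  assumes K: "is_subfield K" "finite K" and fin: "finite W" and W0: "0 \<in> W"
    and diff: "\<And>x y. x \<in> W \<Longrightarrow> y \<in> W \<Longrightarrow> x - y \<in> W"
    and scale: "\<And>c x. c \<in> K \<Longrightarrow> x \<in> W \<Longrightarrow> c * x \<in> W"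
    and card: "card W = card K ^ n"
  shows "linear_poly_on K (vanishing_poly W)"
  unfolding linear_poly_on_def
proof (intro conjI allI ballI)
  let ?e = "vanishing_poly W"
  have pos: "card W > 0"
    using fin W0 by (auto simp: card_gt_0_iff)
  fix x y
  \<comment> \<open>\<open>e(X + y)\<close> and \<open>e(X) + e(y)\<close> are monic of degree \<open>card W\<close> and agree on \<open>W\<close>.\<close>
  define p where "p = (\<Prod>w\<in>W. [:y - w, 1:])"
  have p: "poly p z = poly ?e (z + y)" for z
    by (simp add: p_def poly_vanishing_poly poly_prod algebra_simps)
  have "p = ?e + [:poly ?e y:]"
  proof (rule poly_eqI_degree_lead_coeff[where A = W and n = "card W"])
    \<comment> \<open>Since \<open>card W > 0\<close>, the added constant does not touch the leading
      coefficient.\<close>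
    show "Polynomial.coeff p (card W) = Polynomial.coeff (?e + [:poly ?e y:]) (card W)"
      using pos coeff_prod_linear[of "\<lambda>w. y - w" W] coeff_prod_linear[of uminus W]
      by (simp add: p_def vanishing_poly_def coeff_pCons split: nat.split)
    show "Polynomial.degree p \<le> card W"
      by (simp add: p_def degree_prod_linear)
    show "Polynomial.degree (?e + [:poly ?e y:]) \<le> card W"
      by (rule degree_add_le) (simp_all add: degree_vanishing_poly)
    fix z assume z: "z \<in> W"
    have plus: "z + w \<in> W" if "w \<in> W" for w
      using diff[OF z diff[OF W0 that]] by simp
    \<comment> \<open>Both sides have the value \<open>e(y)\<close> at \<open>z\<close>: on the
      left, the shift by \<open>z\<close> only permutes the factors.\<close>
    have "poly ?e z = 0"
      using fin z by (auto simp: poly_vanishing_poly)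
    moreover have "(\<Prod>w\<in>W. z + y - w) = (\<Prod>w\<in>W. y - w)"
      by (rule prod.reindex_bij_witness[where i="\<lambda>w. z + w" and j="\<lambda>w. w - z"])
         (use z diff plus in auto)
    ultimately show "poly p z = poly (?e + [:poly ?e y:]) z"
      by (simp add: p) (simp add: poly_vanishing_poly)
  qed simp
  then show "poly ?e (x + y) = poly ?e x + poly ?e y"
    using p[of x] by simp
next
  fix c x assume c: "c \<in> K"
  show "poly (vanishing_poly W) (c * x) = c * poly (vanishing_poly W) x"
  proof (cases "c = 0")
    case True
    then show ?thesis using fin W0 by (auto simp: poly_vanishing_poly)
  next
    case False
    have "inverse c \<in> K" using c K by (simp add: is_subfield_def)
    then have "(\<Prod>w\<in>W. c * x - w) = (\<Prod>w\<in>W. c * (x - w))"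
      by (intro prod.reindex_bij_witness[where i="\<lambda>w. c * w" and j="\<lambda>w. inverse c * w"])
         (use False c scale in \<open>auto simp: right_diff_distrib\<close>)
    also have "\<dots> = c ^ card W * (\<Prod>w\<in>W. x - w)"
      by (simp add: prod.distrib)
    finally show ?thesis
      by (simp add: poly_vanishing_poly card is_subfield_power_card_power[OF K c])
  qed
qed

subsection \<open>Interpolation on the span of an independent family\<close>

text \<open>Extensional coefficient functions make the parametrization injective for independent
  \<open>b\<close>, so cardinalities can be read off and sums reindexed.\<close>

definition span_family :: "'a::field set \<Rightarrow> 'i set \<Rightarrow> ('i \<Rightarrow> 'a) \<Rightarrow> 'a set" where
  "span_family K I b = (\<lambda>\<theta>. \<Sum>i\<in>I. \<theta> i * b i) ` (I \<rightarrow>\<^sub>E K)"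

lemma span_familyI:
  assumes "\<And>i. i \<in> I \<Longrightarrow> c i \<in> K"
  shows "(\<Sum>i\<in>I. c i * b i) \<in> span_family K I b"
  unfolding span_family_def by (rule image_eqI[where x = "restrict c I"]) (use assms in auto)

lemma span_familyE:
  assumes "x \<in> span_family K I b"
  obtains c where "\<And>i. i \<in> I \<Longrightarrow> c i \<in> K" "x = (\<Sum>i\<in>I. c i * b i)"
  using assms unfolding span_family_def by (auto simp: PiE_mem)

lemma is_subfield_diff:
  assumes "is_subfield K" "x \<in> K" "y \<in> K"
  shows "x - y \<in> K"
  using assms unfolding is_subfield_def by (metis uminus_add_conv_diff add.commute)

lemma span_family_0:
  assumes "is_subfield K"
  shows "0 \<in> span_family K I b"
  using span_familyI[of I "\<lambda>_. 0" K b] assms by (simp add: is_subfield_def)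

lemma span_family_diff:
  assumes "is_subfield K" "x \<in> span_family K I b" "y \<in> span_family K I b"
  shows "x - y \<in> span_family K I b"
proof -
  obtain c where c: "\<And>i. i \<in> I \<Longrightarrow> c i \<in> K" "x = (\<Sum>i\<in>I. c i * b i)"
    using assms(2) by (rule span_familyE) blast
  obtain e where e: "\<And>i. i \<in> I \<Longrightarrow> e i \<in> K" "y = (\<Sum>i\<in>I. e i * b i)"
    using assms(3) by (rule span_familyE) blast
  have "(\<Sum>i\<in>I. (c i - e i) * b i) \<in> span_family K I b"
    using c e assms(1) by (intro span_familyI is_subfield_diff) auto
  then show ?thesis
    by (simp add: c e sum_subtractf left_diff_distrib)
qed

lemma span_family_scale:
  assumes "is_subfield K" "a \<in> K" "x \<in> span_family K I b"
  shows "a * x \<in> span_family K I b"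
proof -
  obtain c where c: "\<And>i. i \<in> I \<Longrightarrow> c i \<in> K" "x = (\<Sum>i\<in>I. c i * b i)"
    using assms(3) by (rule span_familyE) blast
  have "(\<Sum>i\<in>I. (a * c i) * b i) \<in> span_family K I b"
    using c assms by (intro span_familyI) (auto simp: is_subfield_def)
  then show ?thesis
    by (simp add: c sum_distrib_left mult.assoc)
qed

lemma inj_on_lin_indep_family:
  assumes K: "is_subfield K" and indep: "lin_indep_family K I b"
  shows "inj_on (\<lambda>\<theta>. \<Sum>i\<in>I. \<theta> i * b i) (I \<rightarrow>\<^sub>E K)"
proof (rule inj_onI)
  fix \<theta> \<eta> assume \<theta>: "\<theta> \<in> I \<rightarrow>\<^sub>E K" and \<eta>: "\<eta> \<in> I \<rightarrow>\<^sub>E K"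
    and eq: "(\<Sum>i\<in>I. \<theta> i * b i) = (\<Sum>i\<in>I. \<eta> i * b i)"
  have "(\<Sum>i\<in>I. (\<theta> i - \<eta> i) * b i) = 0"
    using eq by (simp add: left_diff_distrib sum_subtractf)
  moreover have "\<forall>i\<in>I. \<theta> i - \<eta> i \<in> K"
    using \<theta> \<eta> K by (auto intro!: is_subfield_diff)
  ultimately have "\<forall>i\<in>I. \<theta> i - \<eta> i = 0"
    using indep unfolding lin_indep_family_def by (elim allE[where x = "\<lambda>i. \<theta> i - \<eta> i"]) simp
  then show "\<theta> = \<eta>"
    by (intro PiE_ext[OF \<theta> \<eta>]) auto
qed

lemma card_span_family:
  assumes "is_subfield K" "lin_indep_family K I b" "finite I"
  shows "card (span_family K I b) = card K ^ card I"
  unfolding span_family_def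
  using assms by (simp add: card_image inj_on_lin_indep_family card_PiE)

lemma finite_span_family:
  assumes "finite K" "finite I"
  shows "finite (span_family K I b)"
  unfolding span_family_def using assms by (simp add: finite_PiE)

text \<open>Serves the induction in the interpolation lemma: the second conclusion keeps the
  vanishing polynomial of the old span nonzero at the new vector.\<close>

lemma lin_indep_family_insertD:
  assumes K: "is_subfield K" and fin: "finite I" "i \<notin> I" and indep: "lin_indep_family K (insert i I) b"
  shows "lin_indep_family K I b" and "b i \<notin> span_family K I b"
proof -
  show "lin_indep_family K I b"
    unfolding lin_indep_family_def
  proof (intro allI impI)
    fix c assume c: "\<forall>j\<in>I. c j \<in> K" "(\<Sum>j\<in>I. c j * b j) = 0"
    let ?c = "c(i := 0)"
    have "(\<Sum>j\<in>I. ?c j * b j) = (\<Sum>j\<in>I. c j * b j)"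
      using fin by (intro sum.cong) auto
    then have "(\<Sum>j\<in>insert i I. ?c j * b j) = 0"
      using fin c by simp
    moreover have "\<forall>j\<in>insert i I. ?c j \<in> K"
      using c K by (simp add: is_subfield_def)
    ultimately have "\<forall>j\<in>insert i I. ?c j = 0"
      using indep unfolding lin_indep_family_def by blast
    then show "\<forall>j\<in>I. c j = 0"
      using fin by (metis fun_upd_other insertCI)
  qed
  show "b i \<notin> span_family K I b"
  proof
    assume "b i \<in> span_family K I b"
    then obtain c where c: "\<And>j. j \<in> I \<Longrightarrow> c j \<in> K" "b i = (\<Sum>j\<in>I. c j * b j)"
      by (rule span_familyE) blast
    \<comment> \<open>Moving \<open>b i\<close> to the other side gives a relation whose coefficient
      at \<open>i\<close> is nonzero.\<close>
    let ?c = "c(i := - 1)"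
    have "(\<Sum>j\<in>I. ?c j * b j) = (\<Sum>j\<in>I. c j * b j)"
      using fin by (intro sum.cong) auto
    then have "(\<Sum>j\<in>insert i I. ?c j * b j) = 0"
      using fin c by simp
    moreover have "\<forall>j\<in>insert i I. ?c j \<in> K"
      using c K by (simp add: is_subfield_def)
    ultimately have "?c i = 0"
      using indep unfolding lin_indep_family_def by blast
    then show False by simp
  qed
qed

text \<open>
  The degree bound \<open>card K ^ (card I - 1)\<close> is multiplied by \<open>card K\<close> so that it also makes sense
  for empty \<open>I\<close>.
\<close>

lemma ex_linear_interpolation:
  fixes b B :: "'i \<Rightarrow> 'a::field"
  assumes K: "is_subfield K" "finite K" and "finite I" and "lin_indep_family K I b"
  shows "\<exists>f. linear_poly_on K f \<and> card K * Polynomial.degree f \<le> card K ^ card I \<and>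
           (\<forall>i\<in>I. poly f (b i) = B i)"
  using assms(3,4)
proof (induction I rule: finite_induct)
  case empty
  show ?case by (rule exI[of _ 0]) simp
next
  case (insert i I)
  define W where "W = span_family K I b"
  define e where "e = vanishing_poly W"
  note indep = lin_indep_family_insertD[OF K(1) insert.hyps insert.prems]
  obtain f where f: "linear_poly_on K f" "card K * Polynomial.degree f \<le> card K ^ card I"
    "\<And>j. j \<in> I \<Longrightarrow> poly f (b j) = B j"
    using insert.IH[OF indep(1)] by blast
  have cardW: "card W = card K ^ card I"
    unfolding W_def by (rule card_span_family[OF K(1) indep(1) insert.hyps(1)])
  have finW: "finite W"
    unfolding W_def by (rule finite_span_family[OF K(2) insert.hyps(1)])
  have lin: "linear_poly_on K e"
    unfolding e_def
    by (rule linear_vanishing_poly[OF K finW _ _ _ cardW])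
       (auto simp: W_def span_family_0 span_family_diff span_family_scale K)
  have ei: "poly e (b i) \<noteq> 0"
    using indep(2) finW by (auto simp: e_def poly_vanishing_poly W_def)
  have ej: "poly e (b j) = 0" if "j \<in> I" for j
  proof -
    have "(\<Sum>k\<in>I. (if k = j then 1 else 0) * b k) \<in> W"
      unfolding W_def by (rule span_familyI) (use K in \<open>auto simp: is_subfield_def\<close>)
    moreover have "(\<Sum>k\<in>I. (if k = j then 1 else 0) * b k) = b j"
      using that insert.hyps(1) by (simp add: if_distrib[of "\<lambda>x. x * _"] cong: if_cong)
    ultimately show ?thesis
      using finW by (auto simp: e_def poly_vanishing_poly)
  qed
  \<comment> \<open>Newton-style correction: \<open>e\<close> vanishes at every old
    \<open>b j\<close> but not at \<open>b i\<close>, so a multiple of it repairs the value at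
    \<open>b i\<close> alone.\<close>
  define h where "h = f + Polynomial.smult ((B i - poly f (b i)) / poly e (b i)) e"
  have cardK: "card K \<ge> 1"
    using K by (auto simp: is_subfield_def Suc_le_eq card_gt_0_iff)
  \<comment> \<open>The degree of \<open>h\<close> is at most that of \<open>e\<close>; the extra
    factor \<open>card K\<close> then accounts for the new index.\<close>
  have "Polynomial.degree f \<le> card K * Polynomial.degree f"
    using cardK by simp
  then have "Polynomial.degree f \<le> card K ^ card I"
    using f(2) by linarith
  moreover have "Polynomial.degree e = card K ^ card I"
    by (simp add: e_def degree_vanishing_poly cardW)
  ultimately have "Polynomial.degree h \<le> card K ^ card I"
    unfolding h_def by (metis degree_add_le degree_smult_le order_trans)
  then have "card K * Polynomial.degree h \<le> card K ^ card (insert i I)"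
    using insert.hyps by simp
  moreover have "linear_poly_on K h"
    unfolding h_def by (intro linear_poly_on_add linear_poly_on_smult f lin)
  moreover have "\<forall>j\<in>insert i I. poly h (b j) = B j"
    using ei ej f(3) by (auto simp: h_def)
  ultimately show ?case by blast
qed

section \<open>Evaluation of both sides at the constant terms of the quotient polynomials\<close>

theorem theorem2:
  fixes q d s :: nat
    and K :: "'a::field set"
    and b :: "nat \<Rightarrow> 'a"
    and B :: "nat \<Rightarrow> nat \<Rightarrow> 'a"
  assumes "primepow q"
    and "is_subfield K" and "card K = q"
    and "1 \<le> d" and "1 \<le> s" and "s \<le> q"
    and "lin_indep_family K {1..d} b"
  shows "(\<Prod>j=1..s. \<Sum>\<theta> \<in> ({1..d} \<rightarrow>\<^sub>E K) - {\<lambda>i\<in>{1..d}. 0}.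
            (\<Sum>i=1..d. \<theta> i * B i j) / (\<Sum>i=1..d. \<theta> i * b i))
       = (- 1) ^ (s - 1) *
         (\<Sum>\<theta> \<in> ({1..d} \<rightarrow>\<^sub>E K) - {\<lambda>i\<in>{1..d}. 0}.
            (\<Prod>j=1..s. \<Sum>i=1..d. \<theta> i * B i j) / (\<Sum>i=1..d. \<theta> i * b i) ^ s)"
proof -
  let ?I = "{1..d}"
  let ?l = "\<lambda>\<theta>. \<Sum>i=1..d. \<theta> i * b i"
  note K = assms(2)
  define W where "W = span_family K ?I b"
  have K01: "{0, 1} \<subseteq> K" using K by (simp add: is_subfield_def)
  have finK: "finite K"
    using assms(1,3) by (intro card_ge_0_finite) (simp add: primepow_gt_0_nat)
  have q: "q \<ge> 2"
    using card_mono[OF finK K01] assms(3) by simp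
  have finW: "finite W"
    unfolding W_def by (rule finite_span_family[OF finK]) simp
  have cardW: "card W = q ^ d"
    unfolding W_def using card_span_family[OF K assms(7)] assms(3) by simp
  have bij: "bij_betw ?l ((?I \<rightarrow>\<^sub>E K) - {\<lambda>i\<in>?I. 0}) (W - {0})"
  proof -
    note inj = inj_on_lin_indep_family[OF K assms(7)]
    have "{\<lambda>i\<in>?I. 0} \<subseteq> ?I \<rightarrow>\<^sub>E K"
      using K01 by auto
    then have "?l ` ((?I \<rightarrow>\<^sub>E K) - {\<lambda>i\<in>?I. 0}) = W - ?l ` {\<lambda>i\<in>?I. 0}"
      unfolding W_def span_family_def by (intro inj_on_image_set_diff[OF inj]) auto
    then show ?thesis
      using inj_on_subset[OF inj] by (intro bij_betw_imageI) auto
  qed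
  have qd: "q ^ d = q * q ^ (d - 1)"
    using assms(4) by (metis One_nat_def Suc_le_D diff_Suc_1 power_Suc)
  have ex_quotient: "\<exists>g. Polynomial.degree g \<le> q ^ (d - 1) - 1 \<and>
      (\<forall>\<theta> \<in> ?I \<rightarrow>\<^sub>E K. (\<Sum>i=1..d. \<theta> i * B i j) = ?l \<theta> * poly g (?l \<theta>))" for j
  proof -
    obtain f where f: "linear_poly_on K f" "card K * Polynomial.degree f \<le> card K ^ card ?I"
      "\<And>i. i \<in> ?I \<Longrightarrow> poly f (b i) = B i j"
      using ex_linear_interpolation[OF K finK _ assms(7), of "\<lambda>i. B i j"] by auto
    \<comment> \<open>Linearity forces \<open>f(0) = 0\<close>, so X divides \<open>f\<close>; the
      quotient \<open>g\<close> has degree one less unless it is zero.\<close>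
    obtain a g where fg: "f = pCons a g" by (rule pCons_cases)
    then have f_eq: "f = pCons 0 g"
      using linear_poly_on_poly_0[OF f(1)] by simp
    have "Polynomial.degree f \<le> q ^ (d - 1)"
      using f(2) q by (simp add: assms(3) qd)
    then have "Polynomial.degree g \<le> q ^ (d - 1) - 1"
      by (cases "g = 0") (simp_all add: f_eq)
    moreover have "(\<Sum>i=1..d. \<theta> i * B i j) = ?l \<theta> * poly g (?l \<theta>)" if "\<theta> \<in> ?I \<rightarrow>\<^sub>E K" for \<theta>
    proof -
      have "(\<Sum>i=1..d. \<theta> i * B i j) = (\<Sum>i=1..d. \<theta> i * poly f (b i))"
        by (simp add: f(3))
      also have "\<dots> = poly f (?l \<theta>)"
        using that by (intro linear_poly_on_sum[OF f(1), symmetric]) auto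
      finally show ?thesis by (simp add: f_eq)
    qed
    ultimately show ?thesis by blast
  qed
  then obtain g where g: "\<And>j. Polynomial.degree (g j) \<le> q ^ (d - 1) - 1"
    "\<And>j \<theta>. \<theta> \<in> ?I \<rightarrow>\<^sub>E K \<Longrightarrow> (\<Sum>i=1..d. \<theta> i * B i j) = ?l \<theta> * poly (g j) (?l \<theta>)"
    by metis
  have sum_W: "(\<Sum>w\<in>W-{0}. poly p w) = - poly p 0" if "Polynomial.degree p \<le> q ^ d - q" for p
  proof (rule sum_poly_additive_subgroup_nonzero[OF finW])
    \<comment> \<open>Prevents truncation in \<open>q ^ d - q\<close>; with \<open>q \<ge> 2\<close>
      this leaves room for the strict bound.\<close>
    have "q \<le> q ^ d" using assms(4) q by (simp add: self_le_power)
    then show "Polynomial.degree p + 1 < card W"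
      using that q by (simp add: cardW)
  qed (auto simp: W_def span_family_0 span_family_diff K)
  have nz: "?l \<theta> \<noteq> 0" if "\<theta> \<in> (?I \<rightarrow>\<^sub>E K) - {\<lambda>i\<in>?I. 0}" for \<theta>
    using bij_betwE[OF bij] that by blast
  have le: "q * (q ^ (d - 1) - 1) = q ^ d - q"
    by (simp add: qd diff_mult_distrib2)
  have deg: "Polynomial.degree (g j) \<le> q ^ d - q" for j
  proof -
    have "q ^ (d - 1) - 1 \<le> q * (q ^ (d - 1) - 1)" using q by simp
    then show ?thesis using g(1)[of j] by (simp only: le order_trans)
  qed
  have deg_prod: "Polynomial.degree (\<Prod>j=1..s. g j) \<le> q ^ d - q"
  proof -
    have "Polynomial.degree (\<Prod>j=1..s. g j) \<le> (\<Sum>j=1..s. Polynomial.degree (g j))"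
      using degree_prod_sum_le[of "{1..s}" g] by simp
    also have "\<dots> \<le> s * (q ^ (d - 1) - 1)"
      using sum_bounded_above[of "{1..s}" "\<lambda>j. Polynomial.degree (g j)"] g(1) by simp
    \<comment> \<open>Here \<open>s \<le> q\<close> enters: it keeps the product of the
      \<open>g j\<close> within the range where power sums vanish.\<close>
    also have "\<dots> \<le> q * (q ^ (d - 1) - 1)"
      using assms(6) by simp
    finally show ?thesis by (simp only: le)
  qed
  have "(\<Sum>\<theta> \<in> (?I \<rightarrow>\<^sub>E K) - {\<lambda>i\<in>?I. 0}. (\<Sum>i=1..d. \<theta> i * B i j) / ?l \<theta>) = - poly (g j) 0" for j
  proof -
    have "(\<Sum>\<theta> \<in> (?I \<rightarrow>\<^sub>E K) - {\<lambda>i\<in>?I. 0}. (\<Sum>i=1..d. \<theta> i * B i j) / ?l \<theta>)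
        = (\<Sum>\<theta> \<in> (?I \<rightarrow>\<^sub>E K) - {\<lambda>i\<in>?I. 0}. poly (g j) (?l \<theta>))"
    proof (rule sum.cong[OF refl])
      fix \<theta> assume \<theta>: "\<theta> \<in> (?I \<rightarrow>\<^sub>E K) - {\<lambda>i\<in>?I. 0}"
      then show "(\<Sum>i=1..d. \<theta> i * B i j) / ?l \<theta> = poly (g j) (?l \<theta>)"
        using nz[OF \<theta>] g(2)[of \<theta> j] by simp
    qed
    also have "\<dots> = (\<Sum>w\<in>W-{0}. poly (g j) w)"
      by (rule sum.reindex_bij_betw[OF bij])
    finally show ?thesis by (simp add: sum_W deg)
  qed
  then have lhs: "(\<Prod>j=1..s. \<Sum>\<theta> \<in> (?I \<rightarrow>\<^sub>E K) - {\<lambda>i\<in>?I. 0}. (\<Sum>i=1..d. \<theta> i * B i j) / ?l \<theta>)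
      = (- 1) ^ s * (\<Prod>j=1..s. poly (g j) 0)"
    by (simp add: prod_uminus)
  have "(\<Sum>\<theta> \<in> (?I \<rightarrow>\<^sub>E K) - {\<lambda>i\<in>?I. 0}. (\<Prod>j=1..s. \<Sum>i=1..d. \<theta> i * B i j) / ?l \<theta> ^ s)
      = (\<Sum>\<theta> \<in> (?I \<rightarrow>\<^sub>E K) - {\<lambda>i\<in>?I. 0}. poly (\<Prod>j=1..s. g j) (?l \<theta>))"
  proof (rule sum.cong[OF refl])
    fix \<theta> assume \<theta>: "\<theta> \<in> (?I \<rightarrow>\<^sub>E K) - {\<lambda>i\<in>?I. 0}"
    then have "(\<Prod>j=1..s. \<Sum>i=1..d. \<theta> i * B i j) = (\<Prod>j=1..s. ?l \<theta> * poly (g j) (?l \<theta>))"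
      by (intro prod.cong refl g(2)) simp
    also have "\<dots> = ?l \<theta> ^ s * poly (\<Prod>j=1..s. g j) (?l \<theta>)"
      by (simp add: prod.distrib poly_prod)
    finally show "(\<Prod>j=1..s. \<Sum>i=1..d. \<theta> i * B i j) / ?l \<theta> ^ s = poly (\<Prod>j=1..s. g j) (?l \<theta>)"
      using nz[OF \<theta>] by simp
  qed
  also have "\<dots> = (\<Sum>w\<in>W-{0}. poly (\<Prod>j=1..s. g j) w)"
    by (rule sum.reindex_bij_betw[OF bij])
  also have "\<dots> = - (\<Prod>j=1..s. poly (g j) 0)"
    by (simp only: sum_W[OF deg_prod]) (simp only: poly_prod)
  finally have rhs: "(\<Sum>\<theta> \<in> (?I \<rightarrow>\<^sub>E K) - {\<lambda>i\<in>?I. 0}.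
      (\<Prod>j=1..s. \<Sum>i=1..d. \<theta> i * B i j) / ?l \<theta> ^ s) = - (\<Prod>j=1..s. poly (g j) 0)" .
  \<comment> \<open>The left side carries one sign per factor, the right side a single one;
    \<open>s \<ge> 1\<close> makes \<open>s - 1\<close> a true difference.\<close>
  have "(- 1 :: 'a) ^ s = - ((- 1) ^ (s - 1))"
    using assms(5) by (cases s) simp_all
  then show ?thesis
    unfolding lhs rhs by simp
qed

end
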